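(* Let $B$ be a real Banach space which satisfies the condition $( * )$. Then $B$ has the Mazur-Ulam property.
   Context: For a Banach space $B$ over $\mathbb{K}=\mathbb{R}$ or $\mathbb{C}$, $S(B)$ is the unit sphere, $\operatorname{Ball}(B^* )$ the closed unit ball of the dual, $\mathbb{T}=\{z\in\mathbb{K}:|z|=1\}$, and $\mathfrak{F}_B$ the set of all maximal convex subsets of $S(B)$. Let $Q$ be the set of extreme points $q$ of $\operatorname{Ball}(B^* )$ such that $q^{-1}(1)\cap S(B)\in\mathfrak{F}_B$. For $p_1,p_2\in Q$ write $p_1\sim p_2$ if there is $\gamma\in\mathbb{T}$ with $p_1^{-1}(1)\cap S(B)=(\gamma p_2)^{-1}(1)\cap S(B)$; this is an equivalence relation on $Q$. A set of representatives for $\mathfrak{F}_B$ is a subset $P\subset Q$ containing exactly one element of each $\sim$-class. $B$ satisfies the condition $( * )$ if there exists a set of representatives $P$ for $\mathfrak{F}_B$ such that: for every $p\in P$, every $\varepsilon>0$, and every subset $F$ of $P$ that is closed in $P$ for the relative topology induced by the weak*-topology on $B^*$ with $p\notin F$, there exists $a\in S(B)$ such that $p(a)=1$ and $|q(a)|\le\varepsilon$ for all $q\in F$. A real Banach space $B$ has the Mazur-Ulam property if for any real Banach space $B'$, every surjective isometry from $S(B)$ onto $S(B')$ admits an extension to a surjective real-linear isometry from $B$ onto $B'$. *)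

theory Defs
  imports "HOL-Analysis.Analysis"
begin

text \<open>
  A real Banach space \<open>B\<close> is a type of class \<^class>\<open>banach\<close>; its dual is the type
  \<open>'a \<Rightarrow>\<^sub>L real\<close> with the operator norm.
\<close>

definition maximal_convex_subset :: "'a::real_vector set \<Rightarrow> 'a set \<Rightarrow> bool" where
  "maximal_convex_subset S C \<longleftrightarrow>
     C \<subseteq> S \<and> convex C \<and> (\<forall>D. D \<subseteq> S \<longrightarrow> convex D \<longrightarrow> C \<subseteq> D \<longrightarrow> D = C)"

definition max_convex_sets :: "'a::banach set set" where
  "max_convex_sets = {C. maximal_convex_subset (sphere 0 1) C}"

definition dual_face :: "('a::banach \<Rightarrow>\<^sub>L real) \<Rightarrow> 'a set" where
  "dual_face q = blinfun_apply q -` {1} \<inter> sphere 0 1"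

definition face_functionals :: "('a::banach \<Rightarrow>\<^sub>L real) set" where
  "face_functionals = {q. q extreme_point_of (cball 0 1) \<and> dual_face q \<in> max_convex_sets}"

definition face_rel :: "(('a::banach \<Rightarrow>\<^sub>L real) \<times> ('a \<Rightarrow>\<^sub>L real)) set" where
  "face_rel = {(p1, p2). p1 \<in> face_functionals \<and> p2 \<in> face_functionals \<and>
     (\<exists>\<gamma>::real. \<bar>\<gamma>\<bar> = 1 \<and> dual_face p1 = dual_face (\<gamma> *\<^sub>R p2))}"

definition set_of_representatives :: "('a::banach \<Rightarrow>\<^sub>L real) set \<Rightarrow> bool" where
  "set_of_representatives P \<longleftrightarrow>
     P \<subseteq> face_functionals \<and> (\<forall>X \<in> face_functionals // face_rel. \<exists>!p. p \<in> P \<and> p \<in> X)"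

text \<open>
  For scalar-valued operators the strong operator topology is the topology of pointwise
  convergence on the domain, which is the weak* topology of the dual.
\<close>

abbreviation weak_star_topology :: "('a::banach \<Rightarrow>\<^sub>L real) topology" where
  "weak_star_topology \<equiv> strong_operator_topology"

definition condition_star :: "'a::banach itself \<Rightarrow> bool" where
  "condition_star _ \<longleftrightarrow>
     (\<exists>P :: ('a \<Rightarrow>\<^sub>L real) set. set_of_representatives P \<and>
        (\<forall>p \<in> P. \<forall>\<epsilon>>0. \<forall>F. closedin (subtopology weak_star_topology P) F \<longrightarrow> p \<notin> F \<longrightarrow>
           (\<exists>a \<in> sphere 0 1. blinfun_apply p a = 1 \<and> (\<forall>q\<in>F. \<bar>blinfun_apply q a\<bar> \<le> \<epsilon>))))"

definition surj_isometry :: "'a::metric_space set \<Rightarrow> 'b::metric_space set \<Rightarrow> ('a \<Rightarrow> 'b) \<Rightarrow> bool" where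
  "surj_isometry A B f \<longleftrightarrow> f ` A = B \<and> (\<forall>x\<in>A. \<forall>y\<in>A. dist (f x) (f y) = dist x y)"

text \<open>
  HOL has no quantification over types inside a formula, so the target space \<open>B'\<close> is a second
  type argument: \<open>B\<close> has the Mazur-Ulam property if this holds with a type variable
  \<open>'b::banach\<close> as target.
\<close>

definition mazur_ulam_property :: "'a::banach itself \<Rightarrow> 'b::banach itself \<Rightarrow> bool" where
  "mazur_ulam_property _ _ \<longleftrightarrow>
     (\<forall>T :: 'a \<Rightarrow> 'b. surj_isometry (sphere 0 1) (sphere 0 1) T \<longrightarrow>
        (\<exists>U :: 'a \<Rightarrow> 'b. linear U \<and> surj_isometry UNIV UNIV U \<and> (\<forall>x \<in> sphere 0 1. U x = T x)))"

lemma dual_face_sign: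
  fixes p q :: "'a::banach \<Rightarrow>\<^sub>L real" and \<gamma> :: real
  assumes "\<bar>\<gamma>\<bar> = 1" "dual_face p = dual_face (\<gamma> *\<^sub>R q)"
  shows "dual_face (\<gamma> *\<^sub>R p) = dual_face q"
proof -
  have neg: "dual_face (- f) = uminus ` dual_face f" for f :: "'a \<Rightarrow>\<^sub>L real"
  proof (rule set_eqI)
    fix x
    have "x \<in> uminus ` dual_face f \<longleftrightarrow> - x \<in> dual_face f"
      by (metis image_iff minus_minus)
    then show "x \<in> dual_face (- f) \<longleftrightarrow> x \<in> uminus ` dual_face f"
      by (simp add: dual_face_def blinfun.minus_left blinfun.minus_right)
  qed
  consider "\<gamma> = 1" | "\<gamma> = -1" using assms(1) by linarith
  then show ?thesis
    using assms(2) by cases (simp_all add: neg image_image)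
qed

lemma equiv_face_rel:
  "equiv (face_functionals :: ('a::banach \<Rightarrow>\<^sub>L real) set) face_rel"
proof (rule equivI)
  show "face_rel \<subseteq> face_functionals \<times> face_functionals"
    by (auto simp: face_rel_def)
  show "refl_on face_functionals face_rel"
    by (auto simp: refl_on_def face_rel_def intro!: exI[of _ "1::real"])
  show "sym face_rel"
    by (rule symI) (clarsimp simp: face_rel_def, metis dual_face_sign)
  show "trans (face_rel :: (('a \<Rightarrow>\<^sub>L real) \<times> ('a \<Rightarrow>\<^sub>L real)) set)"
  proof (rule transI)
    fix p q r :: "'a \<Rightarrow>\<^sub>L real"
    assume "(p, q) \<in> face_rel" "(q, r) \<in> face_rel"
    then obtain \<gamma> \<delta> :: real where mem: "p \<in> face_functionals" "r \<in> face_functionals"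
      and g: "\<bar>\<gamma>\<bar> = 1" "dual_face p = dual_face (\<gamma> *\<^sub>R q)"
      and d: "\<bar>\<delta>\<bar> = 1" "dual_face q = dual_face (\<delta> *\<^sub>R r)"
      by (auto simp: face_rel_def)
    have "dual_face (\<gamma> *\<^sub>R p) = dual_face (\<delta> *\<^sub>R r)"
      using dual_face_sign[OF g] d(2) by simp
    then have "dual_face (\<gamma> *\<^sub>R (\<delta> *\<^sub>R r)) = dual_face p"
      using dual_face_sign[of \<gamma> "\<delta> *\<^sub>R r" p] g(1) by simp
    then have "dual_face p = dual_face ((\<gamma> * \<delta>) *\<^sub>R r)" by simp
    moreover have "\<bar>\<gamma> * \<delta>\<bar> = 1" using g(1) d(1) by (simp add: abs_mult)
    ultimately show "(p, r) \<in> face_rel" using mem by (auto simp: face_rel_def)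
  qed
qed

end

theory Submission
  imports Defs
begin

text \<open>
  Let \<open>T\<close> be an isometry of \<open>S(B)\<close> onto \<open>S(B')\<close> and \<open>P\<close> a set of representatives as in the
  condition (*). The idea is to recognise the number \<open>p(a)\<close>, for \<open>p \<in> P\<close> and \<open>a \<in> S(B)\<close>, as a
  distance. Write \<open>F\<close> for the face \<open>p\<^sup>-\<^sup>1(1) \<inter> S(B)\<close>. Since \<open>p\<close> has norm at most \<open>1\<close>, always
  \<open>d(a, F) \<ge> 1 - p(a)\<close>; the separation condition gives equality (\<open>near_face\<close>). Now \<open>T\<close> carries
  \<open>F\<close> to a maximal convex set (\<open>sphere_isometry_max_convex\<close>), hence to a face \<open>g\<^sup>-\<^sup>1(1) \<inter> S(B')\<close>, and
  \<open>1 - p(a) = d(a, F) = d(T a, T F) \<ge> 1 - g(T a)\<close>, so that \<open>p(a) \<le> g(T a)\<close>. As also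
  \<open>T(-F) = -T(F)\<close> (\<open>sphere_isometry_max_convex_uminus\<close>), the same argument with \<open>-a\<close> in place
  of \<open>a\<close> gives \<open>g(T a) \<le> p(a)\<close>. Thus \<open>g \<circ> T = p\<close> on \<open>S(B)\<close>. The functionals \<open>g\<close> obtained
  in this way separate the points of \<open>B'\<close>, so the positively homogeneous extension of \<open>T\<close> is
  linear (\<open>homogeneous_extension\<close>).

  Three ingredients carry the argument.

  Every nonempty maximal convex set is the face of an extreme point of the dual ball
  (\<open>max_convex_set_extreme_functional\<close>), so the elements of \<open>P\<close> and their negatives give all maximal
  convex sets. This combines the theorems of Hahn-Banach and Krein-Milman; both are obtained at
  once from Zorn's lemma, applied to sublinear functionals ordered so that a smaller one cuts
  out a face of the set of dominated linear functionals. A minimal one is linear and extreme.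

  Maximal convex sets are preserved because a midpoint remembers its end points: a point at
  distance \<open>2\<close> from the midpoint of \<open>u\<close> and \<open>v\<close> is at distance \<open>2\<close> from \<open>u\<close> and from \<open>v\<close>, and
  distance \<open>2\<close> between points of the sphere detects whether a segment lies in the sphere.

  The equality \<open>d(a, F) = 1 - p(a)\<close> comes from adding to \<open>a\<close> small multiples of vectors peaking
  at \<open>p\<close>. Each of them is chosen after the preceding ones, to be small wherever the
  current vector differs from its value at \<open>p\<close>; hence only the value at \<open>p\<close> matters for the
  growth of the norm.
\<close>

section \<open>Sublinear functionals and extreme dominated functionals\<close>

definition sublinear :: "('a::real_vector \<Rightarrow> real) \<Rightarrow> bool" where
  "sublinear q \<longleftrightarrow> (\<forall>x y. q (x + y) \<le> q x + q y) \<and> (\<forall>x. \<forall>t\<ge>0. q (t *\<^sub>R x) = t * q x)"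

definition dominated :: "('a::real_vector \<Rightarrow> real) \<Rightarrow> ('a \<Rightarrow> real) set" where
  "dominated q = {f. linear f \<and> (\<forall>x. f x \<le> q x)}"

text \<open>
  The last clause says that \<open>dominated q\<close> is a face, in the sense of convexity, of
  \<open>dominated p\<close>. Stating it through open segments makes it match the definition of an extreme
  point.
\<close>

definition sublinear_face :: "('a::real_vector \<Rightarrow> real) \<Rightarrow> ('a \<Rightarrow> real) \<Rightarrow> bool" where
  "sublinear_face q p \<longleftrightarrow> sublinear q \<and> (\<forall>x. q x \<le> p x) \<and>
     (\<forall>g\<in>dominated p. \<forall>h\<in>dominated p. \<forall>u. 0 < u \<longrightarrow> u < 1 \<longrightarrow>
        (\<lambda>x. (1 - u) * g x + u * h x) \<in> dominated q \<longrightarrow> g \<in> dominated q \<and> h \<in> dominated q)"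

text \<open>
  If \<open>q\<close> is constantly \<open>c\<close> on the convex set \<open>F\<close>, this is the largest sublinear functional below
  \<open>q\<close> that takes the value \<open>-c\<close> at the points of \<open>-F\<close>; a dominated linear functional is then
  forced to be \<open>c\<close> on \<open>F\<close>.
\<close>

definition touching :: "('a::real_vector \<Rightarrow> real) \<Rightarrow> 'a set \<Rightarrow> real \<Rightarrow> 'a \<Rightarrow> real" where
  "touching q F c y = (INF (x, t)\<in>F \<times> {0..}. q (y + t *\<^sub>R x) - t * c)"

lemma sublinear_add: "sublinear q \<Longrightarrow> q (x + y) \<le> q x + q y"
  and sublinear_scaleR: "sublinear q \<Longrightarrow> t \<ge> 0 \<Longrightarrow> q (t *\<^sub>R x) = t * q x"
  by (auto simp: sublinear_def)

lemma sublinear_zero: "sublinear q \<Longrightarrow> q 0 = 0"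
  using sublinear_scaleR[of q 0 0] by simp

lemma sublinear_minus: "sublinear q \<Longrightarrow> - q (- x) \<le> q x"
  using sublinear_add[of q x "- x"] sublinear_zero[of q] by simp

lemma touching_le:
  assumes "sublinear q" "\<forall>x\<in>F. q x = c" "x \<in> F" "t \<ge> 0"
  shows "touching q F c y \<le> q (y + t *\<^sub>R x) - t * c"
proof -
  have "bdd_below ((\<lambda>(x, t). q (y + t *\<^sub>R x) - t * c) ` (F \<times> {0..}))"
  proof (rule bdd_belowI[where m = "- q (- y)"], clarsimp)
    fix x and t :: real assume *: "x \<in> F" "0 \<le> t"
    have "t * c = q (t *\<^sub>R x)"
      using sublinear_scaleR[OF assms(1)] assms(2) * by simp
    also have "\<dots> \<le> q (y + t *\<^sub>R x) + q (- y)"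
      using sublinear_add[OF assms(1), of "y + t *\<^sub>R x" "- y"] by simp
    finally show "- q (- y) \<le> q (y + t *\<^sub>R x) - t * c" by simp
  qed
  from cINF_lower[OF this, of "(x, t)"] show ?thesis
    unfolding touching_def using assms(3,4) by simp
qed

lemma touching_ge:
  assumes "F \<noteq> {}" "\<And>x t. x \<in> F \<Longrightarrow> t \<ge> 0 \<Longrightarrow> m \<le> q (y + t *\<^sub>R x) - t * c"
  shows "m \<le> touching q F c y"
  unfolding touching_def using assms by (intro cINF_greatest) auto

text \<open>
  Convexity of \<open>F\<close> is what gives subadditivity: two competing translates \<open>s a\<close> and \<open>t b\<close> add up
  to \<open>(s + t) d\<close> with \<open>d \<in> F\<close>, which is again a competitor.
\<close>

lemma touching_sublinear:
  assumes q: "sublinear q" and F: "convex F" "F \<noteq> {}" "\<forall>x\<in>F. q x = c"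
  shows "sublinear (touching q F c)"
proof -
  let ?T = "touching q F c"
  note le = touching_le[OF q F(3)]
  have add: "?T (y + z) \<le> ?T y + ?T z" for y z
  proof -
    have "?T (y + z) \<le> (q (y + s *\<^sub>R a) - s * c) + (q (z + t *\<^sub>R b) - t * c)"
      if ab: "a \<in> F" "s \<ge> 0" "b \<in> F" "t \<ge> 0" for a s b t
    proof -
      obtain d where d: "d \<in> F" "s *\<^sub>R a + t *\<^sub>R b = (s + t) *\<^sub>R d"
      proof (cases "s + t = 0")
        case True
        then have "s = 0" "t = 0" using ab by linarith+
        with ab that[of a] show ?thesis by simp
      next
        case False
        have "(s / (s + t)) *\<^sub>R a + (t / (s + t)) *\<^sub>R b \<in> F"
          using ab False by (intro convexD[OF F(1)]) (auto simp: add_divide_distrib[symmetric])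
        then show ?thesis using False by (intro that) (auto simp: scaleR_add_right)
      qed
      have "?T (y + z) \<le> q ((y + z) + (s + t) *\<^sub>R d) - (s + t) * c"
        using le[of d "s + t"] d ab by simp
      also have "(y + z) + (s + t) *\<^sub>R d = (y + s *\<^sub>R a) + (z + t *\<^sub>R b)"
        using d(2) by (simp add: algebra_simps)
      also have "q \<dots> \<le> q (y + s *\<^sub>R a) + q (z + t *\<^sub>R b)"
        by (rule sublinear_add[OF q])
      finally show ?thesis by (simp add: algebra_simps)
    qed
    then have 1: "?T (y + z) - (q (y + s *\<^sub>R a) - s * c) \<le> q (z + t *\<^sub>R b) - t * c"
      if "a \<in> F" "s \<ge> 0" "b \<in> F" "t \<ge> 0" for a s b t
      using that by (subst diff_le_eq) (simp only: add.commute)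
    have "?T (y + z) - (q (y + s *\<^sub>R a) - s * c) \<le> ?T z" if "a \<in> F" "s \<ge> 0" for a s
      using F(2) 1[OF that] by (rule touching_ge)
    then have 2: "?T (y + z) - ?T z \<le> q (y + s *\<^sub>R a) - s * c" if "a \<in> F" "s \<ge> 0" for a s
      using that by (subst diff_le_eq) (simp only: diff_le_eq add.commute)
    have "?T (y + z) - ?T z \<le> ?T y" using F(2) 2 by (rule touching_ge)
    then show ?thesis by simp
  qed
  have scale_le: "?T (s *\<^sub>R y) \<le> s * ?T y" if s: "s > 0" for s y
  proof -
    have "?T (s *\<^sub>R y) / s \<le> q (y + t *\<^sub>R x) - t * c" if x: "x \<in> F" "t \<ge> 0" for x t
    proof -
      have "?T (s *\<^sub>R y) \<le> q (s *\<^sub>R y + (s * t) *\<^sub>R x) - (s * t) * c"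
        using le[of x "s * t"] x s by simp
      also have "\<dots> = s * (q (y + t *\<^sub>R x) - t * c)"
        using sublinear_scaleR[OF q, of s "y + t *\<^sub>R x"] s by (simp add: algebra_simps)
      finally show ?thesis using s by (simp add: field_simps)
    qed
    then have "?T (s *\<^sub>R y) / s \<le> ?T y" by (rule touching_ge[OF F(2)])
    then show ?thesis using s by (simp add: field_simps)
  qed
  have "?T (s *\<^sub>R y) = s * ?T y" if "s \<ge> 0" for s y
  proof (cases "s = 0")
    case True
    obtain x where "x \<in> F" using F(2) by blast
    then have "?T 0 \<le> 0" using le[of x 0 0] sublinear_zero[OF q] by simp
    moreover have "0 \<le> ?T 0"
      using F(3) sublinear_scaleR[OF q] by (intro touching_ge[OF F(2)]) simp
    ultimately show ?thesis using True by simp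
  next
    case False
    then have "s > 0" using that by simp
    then show ?thesis
      using scale_le[of s y] scale_le[of "1 / s" "s *\<^sub>R y"] by (simp add: field_simps)
  qed
  with add show ?thesis by (auto simp: sublinear_def)
qed

text \<open>
  This is the purpose of \<open>touching\<close>: passing from \<open>q\<close> to \<open>touching q F c\<close> selects exactly those
  dominated functionals that attain the bound \<open>c\<close> on all of \<open>F\<close>.
\<close>

lemma dominated_touching_iff:
  assumes "sublinear q" "F \<noteq> {}" "\<forall>x\<in>F. q x = c"
  shows "f \<in> dominated (touching q F c) \<longleftrightarrow> f \<in> dominated q \<and> (\<forall>x\<in>F. f x = c)"
proof
  note le = touching_le[OF assms(1,3)]
  assume f: "f \<in> dominated (touching q F c)"
  then have lin: "linear f" and fle: "\<And>x. f x \<le> touching q F c x" by (auto simp: dominated_def)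
  obtain x0 where "x0 \<in> F" using assms(2) by blast
  have dom: "f x \<le> q x" for x
    using fle[of x] le[OF \<open>x0 \<in> F\<close>, of 0 x] by simp
  have "f x = c" if x: "x \<in> F" for x
  proof -
    have "- f x \<le> - c"
      using fle[of "- x"] le[OF x, of 1 "- x"] sublinear_zero[OF assms(1)] linear_neg[OF lin, of x]
      by simp
    then show ?thesis using dom[of x] assms(3) x by simp
  qed
  with dom lin show "f \<in> dominated q \<and> (\<forall>x\<in>F. f x = c)" by (auto simp: dominated_def)
next
  assume f: "f \<in> dominated q \<and> (\<forall>x\<in>F. f x = c)"
  then have lin: "linear f" and fle: "\<And>x. f x \<le> q x" by (auto simp: dominated_def)
  have "f y \<le> touching q F c y" for y
  proof (rule touching_ge[OF assms(2)])
    fix x and t :: real assume "x \<in> F" "t \<ge> 0"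
    then show "f y \<le> q (y + t *\<^sub>R x) - t * c"
      using fle[of "y + t *\<^sub>R x"] f lin by (simp add: linear_add linear_scale)
  qed
  with lin show "f \<in> dominated (touching q F c)" by (simp add: dominated_def)
qed

lemma convex_combination_at_maximum:
  fixes a b c u :: real
  assumes "a \<le> c" "b \<le> c" "0 < u" "u < 1" "(1 - u) * a + u * b = c"
  shows "a = c \<and> b = c"
proof -
  have *: "(1 - u) * (c - a) + u * (c - b) = 0" using assms(5) by (simp add: algebra_simps)
  have "(1 - u) * (c - a) \<ge> 0" "u * (c - b) \<ge> 0" using assms by auto
  with * have "(1 - u) * (c - a) = 0" "u * (c - b) = 0" by linarith+
  then show ?thesis using assms by auto
qed

text \<open>
  On \<open>F\<close> no functional dominated by \<open>q\<close> exceeds \<open>c\<close>, so those that attain \<open>c\<close> form a face.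
\<close>

lemma touching_face:
  assumes "sublinear q" "convex F" "F \<noteq> {}" "\<forall>x\<in>F. q x = c"
  shows "sublinear_face (touching q F c) q"
  unfolding sublinear_face_def
proof (intro conjI allI ballI impI)
  show "sublinear (touching q F c)" by (rule touching_sublinear[OF assms])
  obtain x0 where "x0 \<in> F" using assms(3) by blast
  then show "touching q F c x \<le> q x" for x
    using touching_le[OF assms(1,4), of x0 0 x] by simp
next
  fix g h and u :: real
  assume gh: "g \<in> dominated q" "h \<in> dominated q" and u: "0 < u" "u < 1"
    and comb: "(\<lambda>x. (1 - u) * g x + u * h x) \<in> dominated (touching q F c)"
  have *: "g x = c \<and> h x = c" if "x \<in> F" for x
  proof (rule convex_combination_at_maximum[OF _ _ u])
    show "g x \<le> c" "h x \<le> c" using gh assms(4) that by (auto simp: dominated_def)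
    show "(1 - u) * g x + u * h x = c"
      using comb dominated_touching_iff[OF assms(1,3,4)] that by auto
  qed
  show "g \<in> dominated (touching q F c)" "h \<in> dominated (touching q F c)"
    using * gh dominated_touching_iff[OF assms(1,3,4)] by auto
qed

lemma sublinear_faceD:
  assumes "sublinear_face q p" "g \<in> dominated p" "h \<in> dominated p" "0 < u" "u < 1"
    "(\<lambda>x. (1 - u) * g x + u * h x) \<in> dominated q"
  shows "g \<in> dominated q \<and> h \<in> dominated q"
  using assms unfolding sublinear_face_def by blast

lemma dominated_mono: "(\<And>x. q x \<le> p x) \<Longrightarrow> dominated q \<subseteq> dominated p"
  by (auto simp: dominated_def intro: order_trans)

lemma sublinear_face_trans:
  assumes "sublinear_face r q" "sublinear_face q p"
  shows "sublinear_face r p"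
proof -
  have "dominated r \<subseteq> dominated q"
    using assms(1) by (intro dominated_mono) (simp add: sublinear_face_def)
  moreover have "\<forall>x. r x \<le> p x"
    using assms unfolding sublinear_face_def by (meson order_trans)
  ultimately show ?thesis
    using assms unfolding sublinear_face_def by (meson subsetD)
qed

text \<open>
  The chain condition for Zorn's lemma: subadditivity survives the infimum because any two members
  of the chain have a common lower bound in it, and the infimum is finite because every member
  is bounded below by \<open>- p (- x)\<close>.
\<close>

lemma chain_of_faces_INF:
  assumes ne: "C \<noteq> {}" and faces: "\<And>q. q \<in> C \<Longrightarrow> sublinear_face q p" and p: "sublinear p"
    and chain: "\<And>q r. q \<in> C \<Longrightarrow> r \<in> C \<Longrightarrow> sublinear_face q r \<or> sublinear_face r q"
  defines "m \<equiv> \<lambda>x. INF q\<in>C. q x"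
  shows "q \<in> C \<Longrightarrow> sublinear_face m q"
proof -
  have sub: "sublinear q" and below: "q x \<le> p x" if "q \<in> C" for q x
    using faces[OF that] by (auto simp: sublinear_face_def)
  have m_le: "m x \<le> q x" if "q \<in> C" for q x
  proof -
    have "bdd_below ((\<lambda>q. q x) ` C)"
    proof (rule bdd_belowI[where m = "- p (- x)"], clarsimp)
      fix q assume "q \<in> C"
      then show "- p (- x) \<le> q x"
        using sublinear_minus[OF sub, of q x] below[of q "- x"] by simp
    qed
    from cINF_lower[OF this that] show ?thesis by (simp add: m_def)
  qed
  have m_ge: "k \<le> m x" if "\<And>q. q \<in> C \<Longrightarrow> k \<le> q x" for k x
    unfolding m_def using ne that by (rule cINF_greatest)
  have add: "m (x + y) \<le> m x + m y" for x y
  proof -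
    have "m (x + y) \<le> q x + r y" if qr: "q \<in> C" "r \<in> C" for q r
    proof -
      have "\<exists>s\<in>C. (\<forall>x. s x \<le> q x) \<and> (\<forall>x. s x \<le> r x)"
        using chain[OF qr] qr by (auto simp: sublinear_face_def)
      then obtain s where s: "s \<in> C" "s x \<le> q x" "s y \<le> r y" by blast
      then show ?thesis
        using m_le[OF s(1), of "x + y"] sublinear_add[OF sub, OF s(1), of x y] by simp
    qed
    then have 1: "m (x + y) - q x \<le> r y" if "q \<in> C" "r \<in> C" for q r
      using that by (simp add: diff_le_eq add.commute)
    have "m (x + y) - m y \<le> q x" if "q \<in> C" for q
    proof -
      have "m (x + y) - q x \<le> m y" using 1[OF that] by (rule m_ge)
      then show ?thesis by simp
    qed
    then have "m (x + y) - m y \<le> m x" by (rule m_ge)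
    then show ?thesis by simp
  qed
  have scale_le: "m (t *\<^sub>R x) \<le> t * m x" if t: "t > 0" for t x
  proof -
    have "m (t *\<^sub>R x) / t \<le> m x"
    proof (rule m_ge)
      fix q assume "q \<in> C"
      then show "m (t *\<^sub>R x) / t \<le> q x"
        using m_le[of q "t *\<^sub>R x"] sublinear_scaleR[OF sub, of q t x] t by (simp add: field_simps)
    qed
    then show ?thesis using t by (simp add: field_simps)
  qed
  have "m (t *\<^sub>R x) = t * m x" if "t \<ge> 0" for t x
  proof (cases "t = 0")
    case True
    have "m 0 = (INF q\<in>C. 0::real)"
      unfolding m_def by (rule INF_cong) (auto simp: sublinear_zero[OF sub])
    with True ne show ?thesis by simp
  next
    case False
    then have "t > 0" using that by simp
    then show ?thesis
      using scale_le[of t x] scale_le[of "1 / t" "t *\<^sub>R x"] by (simp add: field_simps)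
  qed
  with add have m_sub: "sublinear m" by (auto simp: sublinear_def)
  have dom_m: "f \<in> dominated m" if "\<And>q. q \<in> C \<Longrightarrow> f \<in> dominated q" for f
    using that ne by (auto simp: dominated_def intro!: m_ge)
  assume q: "q \<in> C"
  show "sublinear_face m q"
    unfolding sublinear_face_def
  proof (intro conjI allI ballI impI)
    show "sublinear m" by (rule m_sub)
    show "m x \<le> q x" for x by (rule m_le[OF q])
  next
    fix g h and u :: real
    assume gh: "g \<in> dominated q" "h \<in> dominated q" and u: "0 < u" "u < 1"
      and comb: "(\<lambda>x. (1 - u) * g x + u * h x) \<in> dominated m"
    have "g \<in> dominated r \<and> h \<in> dominated r" if r: "r \<in> C" for r
      using chain[OF q r]
    proof
      assume "sublinear_face q r"
      then have "dominated q \<subseteq> dominated r"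
        by (intro dominated_mono) (simp add: sublinear_face_def)
      with gh show ?thesis by blast
    next
      assume face: "sublinear_face r q"
      have "(\<lambda>x. (1 - u) * g x + u * h x) \<in> dominated r"
        using comb dominated_mono[of m r] m_le[OF r] by blast
      with face gh u show ?thesis unfolding sublinear_face_def by blast
    qed
    then show "g \<in> dominated m" "h \<in> dominated m" using dom_m by blast+
  qed
qed

text \<open>
  The theorems of Hahn-Banach and Krein-Milman in one: a minimal face \<open>f\<close> of \<open>p\<close> cannot be lowered
  by making it touch at a single point \<open>x\<close>, so \<open>f (- x) = - f x\<close> for all \<open>x\<close>. Hence \<open>f\<close> is
  linear, the only linear functional dominated by \<open>f\<close> is \<open>f\<close> itself, and a one-element face is an
  extreme point.
\<close>

lemma extreme_dominated_exists:
  fixes p :: "'a::real_vector \<Rightarrow> real"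
  assumes p: "sublinear p"
  obtains f where "f \<in> dominated p"
    "\<And>g h u. g \<in> dominated p \<Longrightarrow> h \<in> dominated p \<Longrightarrow> 0 < u \<Longrightarrow> u < 1 \<Longrightarrow>
       f = (\<lambda>x. (1 - u) * g x + u * h x) \<Longrightarrow> g = f \<and> h = f"
proof -
  define A where "A = {q. sublinear_face q p}"
  define R where "R = (\<lambda>q r :: 'a \<Rightarrow> real. sublinear_face r q)"
  have refl: "sublinear_face q q" if "sublinear q" for q :: "'a \<Rightarrow> real"
    using that by (auto simp: sublinear_face_def)
  have antisym: "q = r" if "sublinear_face q r" "sublinear_face r q" for q r :: "'a \<Rightarrow> real"
    using that by (auto simp: sublinear_face_def fun_eq_iff intro: antisym)
  have "\<exists>m\<in>A. \<forall>q\<in>A. R m q \<longrightarrow> q = m"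
  proof (rule predicate_Zorn)
    show "partial_order_on A (relation_of R A)"
    proof (rule partial_order_on_relation_ofI)
      show "R q q" if "q \<in> A" for q
        using that refl by (auto simp: A_def R_def sublinear_face_def)
      show "R q s" if "R q r" "R r s" for q r s
        using that sublinear_face_trans by (auto simp: R_def)
      show "q = r" if "R q r" "R r q" for q r
        using that antisym by (auto simp: R_def)
    qed
    fix C assume C: "C \<in> Chains (relation_of R A)"
    show "\<exists>m\<in>A. \<forall>q\<in>C. R q m"
    proof (cases "C = {}")
      case True
      then show ?thesis using refl[OF p] by (auto simp: A_def)
    next
      case False
      have faces: "sublinear_face q p" if "q \<in> C" for q
        using C that by (auto simp: Chains_def relation_of_def A_def)
      have chain: "sublinear_face q r \<or> sublinear_face r q" if "q \<in> C" "r \<in> C" for q r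
        using C that by (auto simp: Chains_def relation_of_def R_def)
      note m = chain_of_faces_INF[OF False faces p chain]
      obtain q where "q \<in> C" using False by blast
      then have "(\<lambda>x. INF q\<in>C. q x) \<in> A"
        unfolding A_def using sublinear_face_trans[OF m faces] by blast
      then show ?thesis using m by (auto simp: R_def)
    qed
  qed
  then obtain f where f: "sublinear_face f p" and
    min: "\<And>q. sublinear_face q f \<Longrightarrow> q = f"
    unfolding A_def R_def using sublinear_face_trans by blast
  have sub: "sublinear f" using f by (simp add: sublinear_face_def)
  have neg: "f (- x) = - f x" for x
  proof -
    have "touching f {x} (f x) = f"
      using touching_face[OF sub, of "{x}" "f x"] min by auto
    then have "f (- x) \<le> - f x"
      using touching_le[OF sub, of "{x}" "f x" x 1 "- x"] sublinear_zero[OF sub] by simp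
    then show ?thesis using sublinear_minus[OF sub, of x] by simp
  qed
  have lin: "linear f"
  proof (rule linearI)
    fix x y
    show "f (x + y) = f x + f y"
      using sublinear_add[OF sub, of x y] sublinear_add[OF sub, of "x + y" "- y"] neg by simp
  next
    fix t x
    show "f (t *\<^sub>R x) = t *\<^sub>R f x"
      using sublinear_scaleR[OF sub, of t x] sublinear_scaleR[OF sub, of "- t" x] neg[of "t *\<^sub>R x"]
      by (cases "t \<ge> 0") auto
  qed
  have eq: "g = f" if "g \<in> dominated f" for g
  proof
    fix x
    have g: "linear g" "g x \<le> f x" "g (- x) \<le> f (- x)" using that by (auto simp: dominated_def)
    then show "g x = f x" using linear_neg[OF g(1), of x] neg[of x] by simp
  qed
  show ?thesis
  proof (rule that)
    show "f \<in> dominated p" using f lin by (auto simp: dominated_def sublinear_face_def)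
  next
    fix g h and u :: real
    assume *: "g \<in> dominated p" "h \<in> dominated p" "0 < u" "u < 1"
       "f = (\<lambda>x. (1 - u) * g x + u * h x)"
    have "f \<in> dominated f" using lin by (auto simp: dominated_def)
    with * f have "g \<in> dominated f \<and> h \<in> dominated f"
      unfolding sublinear_face_def by metis
    then show "g = f \<and> h = f" using eq by blast
  qed
qed

section \<open>Maximal convex subsets of the unit sphere\<close>

lemma convex_subset_sphere_extends:
  fixes C :: "'a::banach set"
  assumes "C \<subseteq> sphere 0 1" "convex C"
  obtains G where "G \<in> max_convex_sets" "C \<subseteq> G"
proof -
  define \<A> where "\<A> = {D. C \<subseteq> D \<and> D \<subseteq> sphere 0 1 \<and> convex D}"
  have "\<exists>M\<in>\<A>. \<forall>X\<in>\<A>. M \<subseteq> X \<longrightarrow> X = M"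
  proof (rule subset_Zorn_nonempty)
    show "\<A> \<noteq> {}" using assms by (auto simp: \<A>_def)
    fix \<C> assume ne: "\<C> \<noteq> {}" and chain: "subset.chain \<A> \<C>"
    have sub: "\<C> \<subseteq> \<A>" and tot: "\<And>X Y. X \<in> \<C> \<Longrightarrow> Y \<in> \<C> \<Longrightarrow> X \<subseteq> Y \<or> Y \<subseteq> X"
      using chain by (auto simp: subset_chain_def)
    have "convex (\<Union>\<C>)"
    proof (rule convexI)
      fix x y and u v :: real
      assume xy: "x \<in> \<Union>\<C>" "y \<in> \<Union>\<C>" and uv: "0 \<le> u" "0 \<le> v" "u + v = 1"
      from xy tot obtain X where X: "X \<in> \<C>" "x \<in> X" "y \<in> X" by blast
      then have "convex X" using sub by (auto simp: \<A>_def)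
      then show "u *\<^sub>R x + v *\<^sub>R y \<in> \<Union>\<C>" using X uv convexD by blast
    qed
    then show "\<Union>\<C> \<in> \<A>" using ne sub by (auto simp: \<A>_def)
  qed
  then obtain M where M: "M \<in> \<A>" "\<And>X. X \<in> \<A> \<Longrightarrow> M \<subseteq> X \<Longrightarrow> X = M" by blast
  show ?thesis
  proof (rule that)
    show "M \<in> max_convex_sets"
      unfolding max_convex_sets_def maximal_convex_subset_def
    proof (intro CollectI conjI allI impI)
      fix D assume "D \<subseteq> sphere 0 1" "convex D" "M \<subseteq> D"
      with M show "D = M" by (intro M(2)) (auto simp: \<A>_def)
    qed (use M in \<open>auto simp: \<A>_def\<close>)
    show "C \<subseteq> M" using M by (simp add: \<A>_def)
  qed
qed

lemma max_convex_setD: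
  assumes "G \<in> max_convex_sets"
  shows "G \<subseteq> sphere 0 1" "convex G" "\<And>D. D \<subseteq> sphere 0 1 \<Longrightarrow> convex D \<Longrightarrow> G \<subseteq> D \<Longrightarrow> D = G"
  using assms by (auto simp: max_convex_sets_def maximal_convex_subset_def)

lemma blinfun_apply_le_norm: "norm f \<le> 1 \<Longrightarrow> \<bar>blinfun_apply f x\<bar> \<le> norm x"
  for f :: "'a::real_normed_vector \<Rightarrow>\<^sub>L real"
  using norm_blinfun[of f x] mult_right_mono[of "norm f" 1 "norm x"] by simp

lemma convex_dual_face:
  assumes "norm f \<le> 1"
  shows "convex (dual_face f)"
proof (rule convexI)
  fix x y and u v :: real
  assume xy: "x \<in> dual_face f" "y \<in> dual_face f" and uv: "0 \<le> u" "0 \<le> v" "u + v = 1"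
  let ?z = "u *\<^sub>R x + v *\<^sub>R y"
  have f: "blinfun_apply f ?z = 1"
    using xy uv by (simp add: dual_face_def blinfun.add_right blinfun.scaleR_right)
  have "norm ?z \<le> u * norm x + v * norm y"
    using norm_triangle_ineq[of "u *\<^sub>R x" "v *\<^sub>R y"] uv by simp
  then have "norm ?z \<le> 1" using xy uv by (simp add: dual_face_def)
  moreover have "norm ?z \<ge> 1" using blinfun_apply_le_norm[OF assms, of ?z] f by simp
  ultimately show "?z \<in> dual_face f" using f by (simp add: dual_face_def)
qed

lemma dual_face_uminus: "dual_face (- f) = uminus ` dual_face f"
proof (rule set_eqI)
  fix x
  have "x \<in> uminus ` dual_face f \<longleftrightarrow> - x \<in> dual_face f" by (metis image_iff minus_minus)
  then show "x \<in> dual_face (- f) \<longleftrightarrow> x \<in> uminus ` dual_face f"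
    by (simp add: dual_face_def blinfun.minus_left blinfun.minus_right)
qed

text \<open>
  The linear functionals dominated by the norm form the closed dual ball, and those which are \<open>1\<close> on
  \<open>F\<close> are a face of it, described by \<open>touching norm F 1\<close>. An extreme point of that face is
  extreme in the ball, and its own face contains \<open>F\<close>, so by maximality it is \<open>F\<close>.
\<close>

lemma max_convex_set_extreme_functional:
  fixes F :: "'a::banach set"
  assumes F: "F \<in> max_convex_sets" and ne: "F \<noteq> {}"
  obtains f where "f extreme_point_of cball 0 1" "dual_face f = F"
proof -
  let ?N = "norm :: 'a \<Rightarrow> real"
  have N: "sublinear ?N" by (auto simp: sublinear_def norm_triangle_ineq)
  have FN: "\<forall>x\<in>F. ?N x = 1" using max_convex_setD(1)[OF F] by auto
  note touch = dominated_touching_iff[OF N ne FN]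
  show ?thesis
  proof (rule extreme_dominated_exists[OF touching_sublinear[OF N max_convex_setD(2)[OF F] ne FN]])
    fix f
    assume f: "f \<in> dominated (touching ?N F 1)" and
      ext: "\<And>g h u. g \<in> dominated (touching ?N F 1) \<Longrightarrow> h \<in> dominated (touching ?N F 1) \<Longrightarrow>
         0 < u \<Longrightarrow> u < 1 \<Longrightarrow> f = (\<lambda>x. (1 - u) * g x + u * h x) \<Longrightarrow> g = f \<and> h = f"
    have face: "sublinear_face (touching ?N F 1) ?N"
      by (rule touching_face[OF N max_convex_setD(2)[OF F] ne FN])
    have lin: "linear f" and f_le: "f x \<le> norm x" and f1: "x \<in> F \<Longrightarrow> f x = 1" for x
      using f touch by (auto simp: dominated_def)
    have f_abs: "\<bar>f x\<bar> \<le> norm x" for x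
      using f_le[of x] f_le[of "- x"] linear_neg[OF lin, of x] by simp
    have bl: "bounded_linear f"
      using lin f_abs by (intro linear_conv_bounded_linear[THEN iffD1] bounded_linear_intro[where K=1])
         (auto simp: linear_add linear_scale)
    define \<phi> where "\<phi> = Blinfun f"
    have app: "blinfun_apply \<phi> = f" unfolding \<phi>_def by (rule bounded_linear_Blinfun_apply[OF bl])
    have norm\<phi>: "norm \<phi> \<le> 1" using f_abs by (intro norm_blinfun_bound) (auto simp: app)
    have dom: "blinfun_apply g \<in> dominated ?N" if "norm g \<le> 1" for g :: "'a \<Rightarrow>\<^sub>L real"
      using blinfun_apply_le_norm[OF that]
      by (auto simp: dominated_def blinfun.bounded_linear_right bounded_linear.linear abs_le_iff)
    have "\<phi> extreme_point_of cball 0 1"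
      unfolding extreme_point_of_def
    proof (intro conjI ballI notI)
      show "\<phi> \<in> cball 0 1" using norm\<phi> by simp
      fix g h assume gh: "g \<in> cball 0 1" "h \<in> cball 0 1" and seg: "\<phi> \<in> open_segment g h"
      then obtain u where u: "g \<noteq> h" "0 < u" "u < 1" "\<phi> = (1 - u) *\<^sub>R g + u *\<^sub>R h"
        by (auto simp: in_segment)
      have comb: "f = (\<lambda>x. (1 - u) * blinfun_apply g x + u * blinfun_apply h x)"
        unfolding app[symmetric] u(4) by (auto simp: blinfun.add_left blinfun.scaleR_left)
      have "blinfun_apply g \<in> dominated (touching ?N F 1) \<and>
            blinfun_apply h \<in> dominated (touching ?N F 1)"
        using sublinear_faceD[OF face, of "blinfun_apply g" "blinfun_apply h" u] f dom gh u(2,3)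
        by (simp add: comb[symmetric])
      then have "blinfun_apply g = f \<and> blinfun_apply h = f" using ext comb u by blast
      then show False using u(1) by (metis blinfun_apply_inject)
    qed
    moreover have "dual_face \<phi> = F"
    proof (rule max_convex_setD(3)[OF F])
      show "convex (dual_face \<phi>)" by (rule convex_dual_face[OF norm\<phi>])
      show "F \<subseteq> dual_face \<phi>" using f1 FN by (auto simp: dual_face_def app)
    qed (auto simp: dual_face_def)
    ultimately show ?thesis by (rule that)
  qed
qed

section \<open>Isometries between unit spheres and maximal convex sets\<close>

lemma convex_midpoint: "convex C \<Longrightarrow> x \<in> C \<Longrightarrow> y \<in> C \<Longrightarrow> midpoint x y \<in> C"
  by (simp add: midpoint_def scaleR_add_right convexD)

lemma norm_segment_eq_1:
  fixes y z :: "'a::real_normed_vector"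
  assumes "norm y = 1" "norm z = 1" "norm (y + z) = 2" "0 \<le> u" "0 \<le> v" "u + v = 1"
  shows "norm (u *\<^sub>R y + v *\<^sub>R z) = 1"
proof -
  have up: "norm (u *\<^sub>R y + v *\<^sub>R z) \<le> 1"
    using norm_triangle_ineq[of "u *\<^sub>R y" "v *\<^sub>R z"] assms by simp
  have low: "1 \<le> norm (s *\<^sub>R a + t *\<^sub>R b)"
    if "norm a = 1" "norm b = 1" "norm (a + b) = 2" "0 \<le> t" "t \<le> s" "s + t = 1"
    for a b :: 'a and s t :: real
  proof -
    have "s *\<^sub>R a + t *\<^sub>R b = s *\<^sub>R (a + b) - (s - t) *\<^sub>R b" by (simp add: algebra_simps)
    then have "norm (s *\<^sub>R (a + b)) - norm ((s - t) *\<^sub>R b) \<le> norm (s *\<^sub>R a + t *\<^sub>R b)"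
      by (metis norm_triangle_ineq2)
    then show ?thesis using that by simp
  qed
  show ?thesis
  proof (cases "v \<le> u")
    case True
    then show ?thesis using up low[of y z v u] assms by simp
  next
    case False
    then show ?thesis using up low[of z y u v] assms by (simp add: add.commute)
  qed
qed

text \<open>
  The convex hull of \<open>z\<close> and \<open>G\<close> consists of the segments from \<open>z\<close> to points of \<open>G\<close>, and such a
  segment lies in the sphere as soon as its midpoint does. This is how membership in a maximal
  convex set is read off from distances.
\<close>

lemma max_convex_set_absorbs:
  fixes G :: "'a::banach set"
  assumes G: "G \<in> max_convex_sets" and z: "norm z = 1" and "\<And>y. y \<in> G \<Longrightarrow> norm (z + y) = 2"
  shows "z \<in> G"
proof -
  note GD = max_convex_setD[OF G]
  have "convex hull (insert z G) \<subseteq> sphere 0 1"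
  proof (cases "G = {}")
    case True
    then show ?thesis using z by simp
  next
    case False
    show ?thesis
    proof
      fix x assume "x \<in> convex hull (insert z G)"
      then obtain u v b where *: "0 \<le> u" "0 \<le> v" "u + v = 1" "b \<in> G" "x = u *\<^sub>R z + v *\<^sub>R b"
        using False GD(2) by (auto simp: convex_hull_insert convex_hull_eq[THEN iffD2])
      then have "norm b = 1" using GD(1) by auto
      then show "x \<in> sphere 0 1" using norm_segment_eq_1[OF z _ assms(3)] * by simp
    qed
  qed
  moreover have sub: "insert z G \<subseteq> convex hull (insert z G)" by (rule hull_subset)
  ultimately have "convex hull (insert z G) = G"
    by (intro GD(3)) auto
  with sub show ?thesis by blast
qed

lemma surj_isometry_mem: "surj_isometry A B T \<Longrightarrow> x \<in> A \<Longrightarrow> T x \<in> B"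
  and surj_isometry_dist: "surj_isometry A B T \<Longrightarrow> x \<in> A \<Longrightarrow> y \<in> A \<Longrightarrow> dist (T x) (T y) = dist x y"
  and surj_isometry_surj: "surj_isometry A B T \<Longrightarrow> z \<in> B \<Longrightarrow> \<exists>x\<in>A. z = T x"
  by (auto simp: surj_isometry_def)

lemma surj_isometry_inj:
  assumes "surj_isometry A B T"
  shows "inj_on T A"
proof (rule inj_onI)
  fix x y assume "x \<in> A" "y \<in> A" "T x = T y"
  then show "x = y" using surj_isometry_dist[OF assms, of x y] by simp
qed

lemma surj_isometry_inv_into:
  assumes "surj_isometry A B T"
  shows "surj_isometry B A (inv_into A T)"
proof -
  have T: "T ` A = B" "inj_on T A" using assms surj_isometry_inj by (auto simp: surj_isometry_def)
  have "inv_into A T ` B = A" using inv_into_image_cancel[OF T(2), of A] T(1) by simp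
  moreover have "dist (inv_into A T x) (inv_into A T y) = dist x y" if "x \<in> B" "y \<in> B" for x y
    using surj_isometry_dist[OF assms, of "inv_into A T x" "inv_into A T y"] that T(1)
    by (metis f_inv_into_f inv_into_into)
  ultimately show ?thesis by (auto simp: surj_isometry_def)
qed

text \<open>
  For \<open>y \<in> G\<close> the point \<open>-y\<close> is at distance \<open>2\<close> from the image of the midpoint. Its preimage is thus at
  distance \<open>2\<close> from the midpoint, hence, by the triangle inequality, also from \<open>u\<close> and \<open>v\<close>.
  Going back, \<open>-y\<close> is at distance \<open>2\<close> from \<open>T u\<close> and \<open>T v\<close>, and \<open>G\<close> absorbs both. All
  antipodes are taken in the target space.
\<close>

lemma sphere_isometry_midpoint:
  fixes T :: "'a::banach \<Rightarrow> 'b::banach"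
  assumes T: "surj_isometry (sphere 0 1) (sphere 0 1) T"
    and uv: "norm u = 1" "norm v = 1" "norm (midpoint u v) = 1"
    and G: "G \<in> max_convex_sets" "T (midpoint u v) \<in> G"
  shows "T u \<in> G \<and> T v \<in> G"
proof -
  let ?m = "midpoint u v"
  have *: "norm (T u + y) = 2 \<and> norm (T v + y) = 2" if y: "y \<in> G" for y
  proof -
    have "midpoint (T ?m) y \<in> G"
      by (rule convex_midpoint[OF max_convex_setD(2)[OF G(1)] G(2) y])
    then have "norm (midpoint (T ?m) y) = 1" using max_convex_setD(1)[OF G(1)] by auto
    then have 2: "norm (T ?m + y) = 2" by (simp add: midpoint_def)
    have "- y \<in> sphere 0 1" using max_convex_setD(1)[OF G(1)] y by auto
    then obtain w where w: "norm w = 1" "T w = - y"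
      using surj_isometry_surj[OF T] by fastforce
    have d: "norm (T x + y) = norm (x - w)" if "norm x = 1" for x
      using surj_isometry_dist[OF T, of x w] that w by (simp add: dist_norm)
    have "2 *\<^sub>R (?m - w) = (u - w) + (v - w)" by (simp add: midpoint_def algebra_simps scaleR_2)
    then have "2 * norm (?m - w) \<le> norm (u - w) + norm (v - w)"
      by (metis norm_scaleR abs_numeral norm_triangle_ineq)
    moreover have "norm (?m - w) = 2" using d[OF uv(3)] 2 by simp
    moreover have "norm (u - w) \<le> 2" "norm (v - w) \<le> 2"
      using norm_triangle_ineq4[of u w] norm_triangle_ineq4[of v w] uv w by auto
    ultimately show ?thesis using d uv by simp
  qed
  have "norm (T u) = 1" "norm (T v) = 1"
    using surj_isometry_mem[OF T, of u] surj_isometry_mem[OF T, of v] uv by auto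
  then show ?thesis using max_convex_set_absorbs[OF G(1)] * by blast
qed

text \<open>
  Iterated midpoints give, for each finite subset \<open>A\<close> of \<open>C\<close>, a single point of \<open>C\<close> whose image
  draws \<open>T ` A\<close> into every maximal convex set around it. So all convex combinations of points of
  \<open>T ` C\<close> stay in the sphere.
\<close>

lemma sphere_isometry_convex_into_max_convex:
  fixes T :: "'a::banach \<Rightarrow> 'b::banach"
  assumes T: "surj_isometry (sphere 0 1) (sphere 0 1) T"
    and C: "convex C" "C \<subseteq> sphere 0 1"
  obtains G where "G \<in> max_convex_sets" "T ` C \<subseteq> G"
proof -
  have centre: "\<exists>m\<in>C. \<forall>G\<in>max_convex_sets. T m \<in> G \<longrightarrow> T ` A \<subseteq> G"
    if "finite A" "A \<noteq> {}" "A \<subseteq> C" for A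
    using that
  proof (induction A rule: finite_ne_induct)
    case (singleton x)
    then show ?case by auto
  next
    case (insert x A)
    then obtain m where m: "m \<in> C" "\<And>G. G \<in> max_convex_sets \<Longrightarrow> T m \<in> G \<Longrightarrow> T ` A \<subseteq> G" by auto
    have mid: "midpoint x m \<in> C"
      using convex_midpoint[OF C(1)] m(1) insert.prems by simp
    have "norm x = 1" "norm m = 1" "norm (midpoint x m) = 1"
      using C(2) m(1) insert.prems mid by auto
    note half = sphere_isometry_midpoint[OF T this]
    show ?case
    proof (intro bexI[OF _ mid] ballI impI)
      fix G assume "G \<in> max_convex_sets" "T (midpoint x m) \<in> G"
      with half have "T x \<in> G" "T m \<in> G" by auto
      with m(2) \<open>G \<in> max_convex_sets\<close> show "T ` insert x A \<subseteq> G" by auto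
    qed
  qed
  \<comment> \<open>a convex combination involves finitely many points, and these share a maximal convex set\<close>
  have "convex hull (T ` C) \<subseteq> sphere 0 1"
  proof
    fix y assume "y \<in> convex hull (T ` C)"
    then obtain S u where S: "finite S" "S \<subseteq> T ` C" "\<forall>x\<in>S. 0 \<le> u x" "sum u S = 1"
      "(\<Sum>v\<in>S. u v *\<^sub>R v) = y"
      by (auto simp: convex_hull_explicit)
    then obtain A where A: "A \<subseteq> C" "finite A" "S = T ` A" by (meson finite_subset_image)
    have "A \<noteq> {}" using S(4) A(3) by auto
    then obtain m where m: "m \<in> C" and mG: "\<forall>G\<in>max_convex_sets. T m \<in> G \<longrightarrow> S \<subseteq> G"
      using centre[OF A(2) _ A(1)] A(3) by auto
    have "{T m} \<subseteq> sphere 0 1" using surj_isometry_mem[OF T, of m] m C(2) by auto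
    then obtain G where G: "G \<in> max_convex_sets" "T m \<in> G"
      using convex_subset_sphere_extends[of "{T m}"] by auto
    have "y \<in> G"
      using convex_sum[OF S(1) max_convex_setD(2)[OF G(1)] S(4), of "\<lambda>v. v"] S(3,5) mG G by auto
    then show "y \<in> sphere 0 1" using max_convex_setD(1)[OF G(1)] by blast
  qed
  then obtain G where "G \<in> max_convex_sets" "convex hull (T ` C) \<subseteq> G"
    using convex_subset_sphere_extends[of "convex hull (T ` C)"] by auto
  then show ?thesis using that hull_subset[of "T ` C" convex] by blast
qed

text \<open>
  The image of \<open>F\<close> lies in some maximal convex \<open>G\<close>; the preimage of \<open>G\<close> likewise lies in a maximal
  convex set, which contains \<open>F\<close> and therefore equals it.
\<close>

lemma sphere_isometry_max_convex:
  fixes T :: "'a::banach \<Rightarrow> 'b::banach"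
  assumes T: "surj_isometry (sphere 0 1) (sphere 0 1) T" and F: "F \<in> max_convex_sets"
  shows "T ` F \<in> max_convex_sets"
proof -
  note FD = max_convex_setD[OF F]
  let ?I = "inv_into (sphere 0 1) T"
  have inj: "inj_on T (sphere 0 1)" and img: "T ` sphere 0 1 = sphere 0 1"
    using surj_isometry_inj[OF T] T by (auto simp: surj_isometry_def)
  obtain G where G: "G \<in> max_convex_sets" "T ` F \<subseteq> G"
    using sphere_isometry_convex_into_max_convex[OF T FD(2,1)] by blast
  obtain H where H: "H \<in> max_convex_sets" "?I ` G \<subseteq> H"
    using sphere_isometry_convex_into_max_convex[OF surj_isometry_inv_into[OF T]
        max_convex_setD(2,1)[OF G(1)]] by blast
  have "?I ` T ` F = F" using inj FD(1) by (rule inv_into_image_cancel)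
  then have "F \<subseteq> ?I ` G" using G(2) by blast
  moreover from this have "H = F" using FD(3)[OF max_convex_setD(1,2)[OF H(1)]] H(2) by blast
  ultimately have "?I ` G = F" using H(2) by blast
  moreover have "T ` ?I ` G = G"
    using img max_convex_setD(1)[OF G(1)] by (intro image_inv_into_cancel[OF img]) auto
  ultimately show ?thesis using G(1) by simp
qed

lemma max_convex_set_uminus:
  fixes F :: "'a::banach set"
  assumes "F \<in> max_convex_sets"
  shows "uminus ` F \<in> max_convex_sets"
proof -
  have "surj_isometry (sphere 0 1) (sphere 0 1) (uminus :: 'a \<Rightarrow> 'a)"
    unfolding surj_isometry_def
  proof
    show "uminus ` sphere 0 1 = (sphere 0 1 :: 'a set)"
      by (auto simp: image_iff) (metis mem_sphere_0 minus_minus norm_minus_cancel)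
  qed (auto simp: dist_minus)
  then show ?thesis using assms by (rule sphere_isometry_max_convex)
qed

text \<open>
  Points of \<open>F\<close> and of \<open>-F\<close> are at distance \<open>2\<close>, and so are their images. Hence \<open>T ` F\<close>
  absorbs the negatives of the points of \<open>T ` (-F)\<close>, and maximality turns the inclusion into
  equality.
\<close>

lemma sphere_isometry_max_convex_uminus:
  fixes T :: "'a::banach \<Rightarrow> 'b::banach"
  assumes T: "surj_isometry (sphere 0 1) (sphere 0 1) T" and F: "F \<in> max_convex_sets"
  shows "T ` uminus ` F = uminus ` T ` F"
proof -
  note FD = max_convex_setD[OF F]
  have TF: "T ` F \<in> max_convex_sets" and TmF: "T ` uminus ` F \<in> max_convex_sets"
    using sphere_isometry_max_convex[OF T] F max_convex_set_uminus[OF F] by auto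
  have "- T (- x) \<in> T ` F" if x: "x \<in> F" for x
  proof (rule max_convex_set_absorbs[OF TF])
    have mx: "- x \<in> sphere 0 1" using FD(1) x by auto
    then show "norm (- T (- x)) = 1" using surj_isometry_mem[OF T mx] by simp
    fix y assume "y \<in> T ` F"
    then obtain z where z: "z \<in> F" "y = T z" by blast
    have "midpoint z x \<in> F" using convex_midpoint[OF FD(2)] x z by simp
    then have "norm (midpoint z x) = 1" using FD(1) by auto
    then have "norm (z + x) = 2" by (simp add: midpoint_def)
    moreover have "dist (T z) (T (- x)) = dist z (- x)"
      using surj_isometry_dist[OF T _ mx, of z] z FD(1) by blast
    ultimately show "norm (- T (- x) + y) = 2" using z by (simp add: dist_norm)
  qed
  then have "- (- T (- x)) \<in> uminus ` T ` F" if "x \<in> F" for x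
    using that by (intro imageI)
  then have "T ` uminus ` F \<subseteq> uminus ` T ` F" by auto
  moreover have mTF: "uminus ` T ` F \<in> max_convex_sets" by (rule max_convex_set_uminus[OF TF])
  ultimately show ?thesis
    using max_convex_setD(3)[OF TmF max_convex_setD(1,2)[OF mTF]] by blast
qed

section \<open>Distances to the faces under the separation condition\<close>

text \<open>
  What the condition (*) provides, with the topology removed: the closed sets that matter are
  those on which the evaluation at a fixed vector \<open>a\<close> stays away from its value at \<open>p\<close>.
\<close>

locale peaking_functionals =
  fixes P :: "('a::banach \<Rightarrow>\<^sub>L real) set"
  assumes norm_le_1: "p \<in> P \<Longrightarrow> norm p \<le> 1"
    and norming: "x \<noteq> 0 \<Longrightarrow> \<exists>p\<in>P. \<bar>blinfun_apply p x\<bar> = norm x"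
    and peaking: "p \<in> P \<Longrightarrow> \<epsilon> > 0 \<Longrightarrow> \<exists>h. norm h = 1 \<and> blinfun_apply p h = 1 \<and>
      (\<forall>q\<in>P. \<bar>blinfun_apply q a - blinfun_apply p a\<bar> \<ge> \<epsilon> \<longrightarrow> \<bar>blinfun_apply q h\<bar> \<le> \<epsilon>)"
begin

lemma abs_le_norm: "p \<in> P \<Longrightarrow> \<bar>blinfun_apply p x\<bar> \<le> norm x"
  by (rule blinfun_apply_le_norm[OF norm_le_1])

text \<open>
  For \<open>q \<in> P\<close> either \<open>q a\<close> is far from \<open>p a\<close>, and then adding \<open>t h\<close> changes the value by almost nothing,
  or \<open>q a\<close> is close to \<open>p a\<close>, and then the value is at most about \<open>\<bar>p a\<bar> + t\<close>. So the norm
  grows only if the value at \<open>p\<close> was already large.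
\<close>

lemma add_peak:
  assumes p: "p \<in> P" and a: "norm a \<le> M" and t: "0 \<le> t" "\<bar>blinfun_apply p a\<bar> + t \<le> M"
    and "\<epsilon> > 0"
  obtains h where "norm h = 1" "blinfun_apply p h = 1" "norm (a + t *\<^sub>R h) \<le> M + \<epsilon>"
proof -
  \<comment> \<open>small enough for both the error \<open>t e\<close> far from \<open>p\<close> and the error \<open>e\<close> close to it\<close>
  define e where "e = \<epsilon> / (1 + t)"
  have e: "e > 0" "e \<le> \<epsilon>" "t * e \<le> \<epsilon>" using t \<open>\<epsilon> > 0\<close> by (auto simp: e_def field_simps)
  obtain h where h: "norm h = 1" "blinfun_apply p h = 1"
    and small: "\<And>q. q \<in> P \<Longrightarrow> \<bar>blinfun_apply q a - blinfun_apply p a\<bar> \<ge> e \<Longrightarrow> \<bar>blinfun_apply q h\<bar> \<le> e"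
    using peaking[OF p e(1), of a] by blast
  have "norm (a + t *\<^sub>R h) \<le> M + \<epsilon>"
  proof (cases "a + t *\<^sub>R h = 0")
    case True
    then show ?thesis using a \<open>\<epsilon> > 0\<close> norm_ge_zero[of a] by (simp del: norm_ge_zero)
  next
    case False
    then obtain q where q: "q \<in> P" "\<bar>blinfun_apply q (a + t *\<^sub>R h)\<bar> = norm (a + t *\<^sub>R h)"
      using norming by blast
    have "norm (a + t *\<^sub>R h) \<le> \<bar>blinfun_apply q a\<bar> + t * \<bar>blinfun_apply q h\<bar>"
      unfolding q(2)[symmetric] using t(1)
      by (simp add: blinfun.add_right blinfun.scaleR_right)
        (metis abs_mult abs_of_nonneg abs_triangle_ineq)
    also have "\<dots> \<le> M + \<epsilon>"
    proof (cases "\<bar>blinfun_apply q a - blinfun_apply p a\<bar> \<ge> e")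
      case True
      then have "t * \<bar>blinfun_apply q h\<bar> \<le> t * e"
        using small[OF q(1)] t(1) by (intro mult_left_mono) auto
      then show ?thesis using abs_le_norm[OF q(1), of a] a e by linarith
    next
      case False
      have "t * \<bar>blinfun_apply q h\<bar> \<le> t * 1"
        using abs_le_norm[OF q(1), of h] h t(1) by (intro mult_left_mono) auto
      then show ?thesis using False t(2) e by linarith
    qed
    finally show ?thesis .
  qed
  with h show ?thesis by (rule that)
qed

text \<open>
  Adding \<open>1 - p a\<close> times one peaking vector would not do when \<open>p a\<close> is negative, because that
  vector may take the value \<open>-1\<close> close to \<open>p\<close>. In many steps of length \<open>t\<close> the value at \<open>p\<close> always
  stays in \<open>[-1, 1]\<close>, so the norm never exceeds \<open>1 + t\<close> by more than the accumulated error.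
\<close>

lemma approach_face:
  assumes p: "p \<in> P" and a: "norm a \<le> 1" and "\<eta> > 0"
  obtains b where "blinfun_apply p b = 1" "norm (b - a) \<le> 1 - blinfun_apply p a" "norm b \<le> 1 + \<eta>"
proof -
  let ?s = "blinfun_apply p a"
  have s: "\<bar>?s\<bar> \<le> 1" using abs_le_norm[OF p, of a] a by simp
  obtain n :: nat where n: "n > 0" "2 * (1 - ?s) / \<eta> < n"
    using reals_Archimedean2[of "max 0 (2 * (1 - ?s) / \<eta>)"] by auto
  define t where "t = (1 - ?s) / n"
  \<comment> \<open>half of \<open>\<eta>\<close> is spent on the step length \<open>t\<close>, half on the \<open>n\<close> errors\<close>
  define e where "e = \<eta> / (2 * n)"
  have t: "t \<ge> 0" "t \<le> \<eta> / 2" "n * t = 1 - ?s"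
    using n s \<open>\<eta> > 0\<close> by (auto simp: t_def field_simps)
  have e: "e > 0" "n * e = \<eta> / 2" using n \<open>\<eta> > 0\<close> by (auto simp: e_def)
  have "\<exists>b. blinfun_apply p b = ?s + k * t \<and> norm (b - a) \<le> k * t \<and> norm b \<le> 1 + t + k * e"
    if "k \<le> n" for k :: nat
    using that
  proof (induction k)
    case 0
    then show ?case using a t(1) by (intro exI[of _ a]) simp
  next
    case (Suc k)
    then obtain b where b: "blinfun_apply p b = ?s + k * t" "norm (b - a) \<le> k * t"
      "norm b \<le> 1 + t + k * e" by auto
    have "k * t \<le> n * t" using Suc.prems t(1) by (intro mult_right_mono) auto
    moreover have "k * t \<ge> 0" "k * e \<ge> 0" using t(1) e(1) by auto
    ultimately have "\<bar>blinfun_apply p b\<bar> + t \<le> 1 + t + k * e"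
      using b(1) s t(3) by linarith
    then obtain h where h: "norm h = 1" "blinfun_apply p h = 1"
      "norm (b + t *\<^sub>R h) \<le> 1 + t + k * e + e"
      using add_peak[OF p b(3) t(1) _ e(1)] by blast
    have "norm (b + t *\<^sub>R h - a) \<le> norm (b - a) + norm (t *\<^sub>R h)"
      using norm_triangle_ineq[of "b - a" "t *\<^sub>R h"] by (simp add: algebra_simps)
    then have "norm (b + t *\<^sub>R h - a) \<le> k * t + t" using b(2) h(1) t(1) by simp
    then show ?case using h b(1)
      by (intro exI[of _ "b + t *\<^sub>R h"])
        (simp add: blinfun.add_right blinfun.scaleR_right algebra_simps)
  qed
  from this[of n] obtain b where "blinfun_apply p b = ?s + n * t" "norm (b - a) \<le> n * t"
    "norm b \<le> 1 + t + n * e" by blast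
  then show ?thesis using that[of b] t e by simp
qed

text \<open>
  Replacing \<open>b\<close> by the weighted mean of \<open>b\<close> and a vector \<open>h\<close> peaking at \<open>p\<close> scales down the
  values far from \<open>p\<close>, while close to \<open>p\<close> the mean cannot exceed \<open>1\<close> by much; the value at \<open>p\<close>
  remains \<open>1\<close>.
\<close>

lemma halve_excess:
  assumes p: "p \<in> P" and b: "blinfun_apply p b = 1" "norm b \<le> 1 + \<eta>" and \<eta>: "\<eta> > 0" "\<eta> \<le> 1"
  obtains c where "blinfun_apply p c = 1" "norm c \<le> 1 + \<eta> / 2" "norm (c - b) \<le> 3 * \<eta>"
proof -
  obtain h where h: "norm h = 1" "blinfun_apply p h = 1" "norm (b + \<eta> *\<^sub>R h) \<le> 1 + \<eta> + \<eta> / 2"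
    using add_peak[OF p b(2), of \<eta> "\<eta> / 2"] b(1) \<eta> by auto
  define c where "c = (1 / (1 + \<eta>)) *\<^sub>R (b + \<eta> *\<^sub>R h)"
  have pos: "1 + \<eta> > 0" using \<eta> by simp
  have 1: "blinfun_apply p c = 1"
    using b(1) h(2) pos by (simp add: c_def blinfun.add_right blinfun.scaleR_right)
  have "(1 + \<eta>) * norm c = norm (b + \<eta> *\<^sub>R h)" using pos by (simp add: c_def)
  also have "\<dots> \<le> 1 + \<eta> + \<eta> / 2 + \<eta> * \<eta> / 2" using h(3) zero_le_square[of \<eta>] by linarith
  also have "\<dots> = (1 + \<eta>) * (1 + \<eta> / 2)" by (simp add: algebra_simps add_divide_distrib)
  finally have 2: "norm c \<le> 1 + \<eta> / 2" using pos by simp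
  have "(1 + \<eta>) *\<^sub>R (c - b) = (1 + \<eta>) *\<^sub>R c - (1 + \<eta>) *\<^sub>R b" by (rule scaleR_diff_right)
  also have "\<dots> = \<eta> *\<^sub>R (h - b)"
    using pos by (simp add: c_def scaleR_right_diff_distrib scaleR_left_distrib)
  finally have "(1 + \<eta>) * norm (c - b) = \<eta> * norm (h - b)"
    using pos \<eta>(1) by (metis abs_of_pos norm_scaleR)
  also have "\<dots> \<le> \<eta> * 3"
    using norm_triangle_ineq4[of h b] h(1) b(2) \<eta> by (intro mult_left_mono) auto
  finally have "(1 + \<eta>) * norm (c - b) \<le> \<eta> * 3" .
  moreover have "1 * norm (c - b) \<le> (1 + \<eta>) * norm (c - b)" using \<eta> by (intro mult_right_mono) auto
  ultimately have "norm (c - b) \<le> 3 * \<eta>" by simp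
  with 1 2 show ?thesis by (rule that)
qed

text \<open>
  Here completeness of the space enters: the corrections of \<open>halve_excess\<close> form a geometric series,
  with the initial excess \<open>\<eta>\<close> giving total length at most \<open>3 \<eta> (1 + 1/2 + 1/4 + ...) = 6 \<eta>\<close>.
\<close>

lemma correct_to_face:
  assumes p: "p \<in> P" and b: "blinfun_apply p b = 1" "norm b \<le> 1 + \<eta>" and \<eta>: "\<eta> > 0" "\<eta> \<le> 1"
  obtains c where "c \<in> dual_face p" "norm (c - b) \<le> 6 * \<eta>"
proof -
  let ?e = "\<lambda>k::nat. \<eta> * (1/2) ^ k"
  have "\<exists>c. \<forall>k. (blinfun_apply p (c k) = 1 \<and> norm (c k) \<le> 1 + ?e k \<and> (k = 0 \<longrightarrow> c k = b)) \<and>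
       norm (c (Suc k) - c k) \<le> 3 * ?e k"
  proof (rule dependent_nat_choice)
    show "\<exists>x. blinfun_apply p x = 1 \<and> norm x \<le> 1 + ?e 0 \<and> (0 = (0::nat) \<longrightarrow> x = b)"
      using b by auto
    fix x and k :: nat
    assume x: "blinfun_apply p x = 1 \<and> norm x \<le> 1 + ?e k \<and> (k = 0 \<longrightarrow> x = b)"
    have "?e k > 0" "?e k \<le> 1"
      using \<eta> mult_mono[of \<eta> 1 "(1/2) ^ k" 1] by (auto simp: power_le_one)
    with x obtain y where "blinfun_apply p y = 1" "norm y \<le> 1 + ?e k / 2" "norm (y - x) \<le> 3 * ?e k"
      using halve_excess[OF p, of x "?e k"] by blast
    then show "\<exists>y. (blinfun_apply p y = 1 \<and> norm y \<le> 1 + ?e (Suc k) \<and> (Suc k = 0 \<longrightarrow> y = b)) \<and>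
       norm (y - x) \<le> 3 * ?e k"
      by (intro exI[of _ y]) simp
  qed
  then obtain c where c: "\<And>k. blinfun_apply p (c k) = 1" "\<And>k. norm (c k) \<le> 1 + ?e k" "c 0 = b"
    "\<And>k. norm (c (Suc k) - c k) \<le> 3 * ?e k" by blast
  have sums: "(\<lambda>k. 3 * ?e k) sums (6 * \<eta>)"
    using sums_mult[OF geometric_sums[of "1/2::real"], of "3 * \<eta>"] by (simp add: mult.assoc)
  have summ: "summable (\<lambda>k. c (Suc k) - c k)"
    by (rule summable_comparison_test'[OF sums_summable[OF sums]]) (rule c(4))
  define d where "d = (\<Sum>k. c (Suc k) - c k)"
  have "norm d \<le> (\<Sum>k. 3 * ?e k)"
    unfolding d_def by (rule norm_suminf_le[OF c(4) sums_summable[OF sums]])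
  then have d: "norm d \<le> 6 * \<eta>" using sums_unique[OF sums] by simp
  have "(\<lambda>n. \<Sum>k<n. c (Suc k) - c k) \<longlonglongrightarrow> d"
    using summable_LIMSEQ[OF summ] by (simp add: d_def)
  then have "(\<lambda>n. c n - b) \<longlonglongrightarrow> d" by (simp add: sum_lessThan_telescope c(3))
  from tendsto_add[OF this tendsto_const[of b]] have lim: "c \<longlonglongrightarrow> d + b" by simp
  have "(\<lambda>n. blinfun_apply p (c n)) \<longlonglongrightarrow> blinfun_apply p (d + b)"
    by (intro tendsto_intros lim)
  then have p1: "blinfun_apply p (d + b) = 1"
    unfolding c(1) by (simp add: LIMSEQ_const_iff)
  have "(\<lambda>k. 1 + ?e k) \<longlonglongrightarrow> 1 + \<eta> * 0"
    by (intro tendsto_intros LIMSEQ_power_zero) simp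
  then have "norm (d + b) \<le> 1 + \<eta> * 0"
    using c(2) tendsto_norm[OF lim] by (intro LIMSEQ_le[of "\<lambda>k. norm (c k)"]) auto
  moreover have "1 \<le> norm (d + b)" using abs_le_norm[OF p, of "d + b"] p1 by simp
  ultimately have "d + b \<in> dual_face p" using p1 by (simp add: dual_face_def)
  then show ?thesis using d by (intro that[of "d + b"]) auto
qed

text \<open>
  Together with the trivial lower bound, this says that the distance from \<open>a\<close> to the face of \<open>p\<close>
  is \<open>1 - p a\<close>.
\<close>

lemma near_face:
  assumes p: "p \<in> P" and a: "norm a \<le> 1" and "\<epsilon> > 0"
  obtains c where "c \<in> dual_face p" "dist a c \<le> 1 - blinfun_apply p a + \<epsilon>"
proof -
  \<comment> \<open>the correction onto the face costs \<open>6 \<eta>\<close> and requires \<open>\<eta> \<le> 1\<close>\<close>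
  define \<eta> where "\<eta> = min 1 (\<epsilon> / 6)"
  have \<eta>: "\<eta> > 0" "\<eta> \<le> 1" "6 * \<eta> \<le> \<epsilon>" using \<open>\<epsilon> > 0\<close> by (auto simp: \<eta>_def)
  obtain b where b: "blinfun_apply p b = 1" "norm (b - a) \<le> 1 - blinfun_apply p a" "norm b \<le> 1 + \<eta>"
    using approach_face[OF p a \<eta>(1)] by blast
  obtain c where c: "c \<in> dual_face p" "norm (c - b) \<le> 6 * \<eta>"
    using correct_to_face[OF p b(1,3) \<eta>(1,2)] by blast
  have "dist a c \<le> norm (b - a) + norm (c - b)"
    using dist_triangle[of a c b] by (simp add: dist_norm norm_minus_commute)
  then show ?thesis using that[OF c(1)] b(2) c(2) \<eta>(3) by simp
qed

end

text \<open>
  A unit vector lies in some maximal convex set, and that set is the face of an extreme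
  functional. The representative of its class differs from it by a sign as far as faces are
  concerned; this shows both that \<open>P\<close> is norming and that its faces, up to sign, are all the
  nonempty maximal convex sets.
\<close>

lemma condition_star_peaking:
  assumes "condition_star TYPE('a::banach)"
  obtains P :: "('a::banach \<Rightarrow>\<^sub>L real) set" where "peaking_functionals P"
    "\<And>p. p \<in> P \<Longrightarrow> dual_face p \<in> max_convex_sets"
    "\<And>F. F \<in> max_convex_sets \<Longrightarrow> F \<noteq> {} \<Longrightarrow> \<exists>p\<in>P. F = dual_face p \<or> F = uminus ` dual_face p"
proof -
  obtain P :: "('a \<Rightarrow>\<^sub>L real) set" where rep: "set_of_representatives P"
    and sep: "\<forall>p\<in>P. \<forall>\<epsilon>>0. \<forall>F. closedin (subtopology weak_star_topology P) F \<longrightarrow> p \<notin> F \<longrightarrow>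
           (\<exists>a\<in>sphere 0 1. blinfun_apply p a = 1 \<and> (\<forall>q\<in>F. \<bar>blinfun_apply q a\<bar> \<le> \<epsilon>))"
    using assms unfolding condition_star_def by (elim exE conjE)
  have P: "P \<subseteq> face_functionals" using rep by (simp add: set_of_representatives_def)
  have faces: "dual_face p \<in> max_convex_sets" if "p \<in> P" for p
    using P that by (auto simp: face_functionals_def)
  have cover: "\<exists>p\<in>P. F = dual_face p \<or> F = uminus ` dual_face p"
    if F: "F \<in> max_convex_sets" "F \<noteq> {}" for F
  proof -
    obtain f where f: "f extreme_point_of cball 0 1" "dual_face f = F"
      using max_convex_set_extreme_functional[OF F] by blast
    then have "f \<in> face_functionals" using F by (simp add: face_functionals_def)
    then have "face_rel `` {f} \<in> face_functionals // face_rel" by (rule quotientI)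
    then obtain p where p: "p \<in> P" "p \<in> face_rel `` {f}"
      using rep unfolding set_of_representatives_def by blast
    then obtain \<gamma> :: real where "\<bar>\<gamma>\<bar> = 1" "dual_face f = dual_face (\<gamma> *\<^sub>R p)"
      by (auto simp: face_rel_def)
    moreover from this have "\<gamma> = 1 \<or> \<gamma> = -1" by linarith
    ultimately have "F = dual_face p \<or> F = uminus ` dual_face p"
      using f(2) dual_face_uminus[of p] by auto
    with p(1) show ?thesis by blast
  qed
  have "peaking_functionals P"
  proof
    show "norm p \<le> 1" if "p \<in> P" for p
      using P that by (auto simp: face_functionals_def extreme_point_of_def)
  next
    fix x :: 'a assume "x \<noteq> 0"
    then have "{x /\<^sub>R norm x} \<subseteq> sphere 0 1" by simp
    then obtain F where F: "F \<in> max_convex_sets" "x /\<^sub>R norm x \<in> F"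
      using convex_subset_sphere_extends[of "{x /\<^sub>R norm x}"] by auto
    then obtain p where p: "p \<in> P" "F = dual_face p \<or> F = uminus ` dual_face p"
      using cover[of F] by blast
    then have "\<bar>blinfun_apply p (x /\<^sub>R norm x)\<bar> = 1"
      using F(2) by (auto simp: dual_face_def blinfun.minus_right)
    then have "\<bar>blinfun_apply p x\<bar> = norm x"
      using \<open>x \<noteq> 0\<close> by (simp add: blinfun.scaleR_right abs_mult field_simps)
    with p(1) show "\<exists>p\<in>P. \<bar>blinfun_apply p x\<bar> = norm x" by blast
  next
    fix p and \<epsilon> :: real and a :: 'a assume p: "p \<in> P" and "\<epsilon> > 0"
    let ?F = "{q \<in> topspace (subtopology weak_star_topology P).
                 blinfun_apply q a \<in> {s. \<epsilon> \<le> \<bar>s - blinfun_apply p a\<bar>}}"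
    have "closed {s. \<epsilon> \<le> \<bar>s - blinfun_apply p a\<bar>}"
      by (intro closed_Collect_le continuous_intros)
    then have "closedin (subtopology weak_star_topology P) ?F"
      by (intro closedin_continuous_map_preimage[where Y = euclidean]
          continuous_map_from_subtopology strong_operator_topology_continuous_evaluation) simp
    moreover have "p \<notin> ?F" using \<open>\<epsilon> > 0\<close> by simp
    ultimately obtain h where "h \<in> sphere 0 1" "blinfun_apply p h = 1"
      "\<forall>q\<in>?F. \<bar>blinfun_apply q h\<bar> \<le> \<epsilon>"
      using sep p \<open>\<epsilon> > 0\<close> by meson
    then show "\<exists>h. norm h = 1 \<and> blinfun_apply p h = 1 \<and>
      (\<forall>q\<in>P. \<epsilon> \<le> \<bar>blinfun_apply q a - blinfun_apply p a\<bar> \<longrightarrow> \<bar>blinfun_apply q h\<bar> \<le> \<epsilon>)"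
      by (intro exI[of _ h]) (auto simp: strong_operator_topology_topspace)
  qed
  then show ?thesis using faces cover by (rule that)
qed

section \<open>The extension\<close>

text \<open>
  The relation \<open>\<psi>\<^sub>i \<circ> T = \<phi>\<^sub>i\<close> passes to the homogeneous extension \<open>U\<close>. Linearity of \<open>U\<close> can then be
  tested against the \<open>\<psi>\<^sub>i\<close>, where it is the linearity of the \<open>\<phi>\<^sub>i\<close>.
\<close>

lemma homogeneous_extension:
  fixes T :: "'a::banach \<Rightarrow> 'b::banach" and \<phi> :: "'c \<Rightarrow> 'a \<Rightarrow>\<^sub>L real" and \<psi> :: "'c \<Rightarrow> 'b \<Rightarrow>\<^sub>L real"
  assumes T: "T ` sphere 0 1 = sphere 0 1"
    and conj: "\<And>i x. i \<in> I \<Longrightarrow> norm x = 1 \<Longrightarrow> blinfun_apply (\<psi> i) (T x) = blinfun_apply (\<phi> i) x"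
    and sep: "\<And>y. y \<noteq> 0 \<Longrightarrow> \<exists>i\<in>I. blinfun_apply (\<psi> i) y \<noteq> 0"
  shows "\<exists>U. linear U \<and> surj_isometry UNIV UNIV U \<and> (\<forall>x\<in>sphere 0 1. U x = T x)"
proof -
  define U where "U x = norm x *\<^sub>R T (x /\<^sub>R norm x)" for x
  have \<psi>U: "blinfun_apply (\<psi> i) (U x) = blinfun_apply (\<phi> i) x" if "i \<in> I" for i x
    using conj[OF that, of "x /\<^sub>R norm x"]
    by (cases "x = 0") (simp_all add: U_def blinfun.scaleR_right)
  have eqI: "y = z" if "\<And>i. i \<in> I \<Longrightarrow> blinfun_apply (\<psi> i) y = blinfun_apply (\<psi> i) z" for y z
    using sep[of "y - z"] that by (auto simp: blinfun.diff_right)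
  have lin: "linear U"
  proof (rule linearI)
    show "U (x + y) = U x + U y" for x y
      by (rule eqI) (simp add: \<psi>U blinfun.add_right)
    show "U (t *\<^sub>R x) = t *\<^sub>R U x" for t x
      by (rule eqI) (simp add: \<psi>U blinfun.scaleR_right)
  qed
  have normU: "norm (U x) = norm x" for x
  proof (cases "x = 0")
    case False
    then have "x /\<^sub>R norm x \<in> sphere 0 1" by simp
    then have "norm (T (x /\<^sub>R norm x)) = 1" using T by (metis image_eqI mem_sphere_0)
    then show ?thesis by (simp add: U_def)
  qed (simp add: U_def)
  have UT: "U x = T x" if "x \<in> sphere 0 1" for x using that by (simp add: U_def)
  have "y \<in> range U" for y
  proof (cases "y = 0")
    case True
    then show ?thesis by (metis linear_0[OF lin] rangeI)
  next
    case False
    then have "y /\<^sub>R norm y \<in> sphere 0 1" by simp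
    then obtain x where "x \<in> sphere 0 1" "T x = y /\<^sub>R norm y" using T by (metis imageE)
    then have "U (norm y *\<^sub>R x) = y" using False UT by (simp add: linear_scale[OF lin])
    then show ?thesis by (metis rangeI)
  qed
  then have "surj_isometry UNIV UNIV U"
    using normU by (auto simp: surj_isometry_def dist_norm linear_diff[OF lin, symmetric])
  with lin UT show ?thesis by blast
qed

theorem theorem6p1:
  assumes "condition_star TYPE('a::banach)"
  shows "mazur_ulam_property TYPE('a) TYPE('b::banach)"
  unfolding mazur_ulam_property_def
proof (intro allI impI)
  fix T :: "'a \<Rightarrow> 'b" assume T: "surj_isometry (sphere 0 1) (sphere 0 1) T"
  obtain P :: "('a \<Rightarrow>\<^sub>L real) set" where P: "peaking_functionals P"
    and faces: "\<And>p. p \<in> P \<Longrightarrow> dual_face p \<in> max_convex_sets"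
    and cover: "\<And>F. F \<in> max_convex_sets \<Longrightarrow> F \<noteq> {} \<Longrightarrow> \<exists>p\<in>P. F = dual_face p \<or> F = uminus ` dual_face p"
    using condition_star_peaking[OF assms] by blast
  interpret peaking_functionals P by (rule P)
  have img: "T ` sphere 0 1 = sphere 0 1" using T by (simp add: surj_isometry_def)
  have "\<exists>g. norm g \<le> 1 \<and> dual_face g = T ` dual_face p" if p: "p \<in> P" for p
  \<comment> \<open>an empty face occurs only for the zero space, whose unit sphere is empty\<close>
  proof (cases "dual_face p = {}")
    case True
    then have "sphere 0 1 = ({} :: 'a set)"
      using faces[OF p] max_convex_set_absorbs[of "{}"] by fastforce
    then have "sphere 0 1 = ({} :: 'b set)" using img by simp
    with True show ?thesis by (intro exI[of _ 0]) (simp add: dual_face_def)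
  next
    case False
    then obtain g where "g extreme_point_of cball 0 1" "dual_face g = T ` dual_face p"
      using max_convex_set_extreme_functional[OF sphere_isometry_max_convex[OF T faces[OF p]]] by blast
    then show ?thesis by (auto simp: extreme_point_of_def)
  qed
  then obtain \<psi> where \<psi>: "\<And>p. p \<in> P \<Longrightarrow> norm (\<psi> p) \<le> 1"
    "\<And>p. p \<in> P \<Longrightarrow> dual_face (\<psi> p) = T ` dual_face p"
    by metis
  have conj: "blinfun_apply (\<psi> p) (T a) = blinfun_apply p a" if p: "p \<in> P" and a: "norm a = 1" for p a
  proof (rule antisym)
    have aS: "a \<in> sphere 0 1" using a by simp
    have dT: "\<bar>blinfun_apply (\<psi> p) (T a) - blinfun_apply (\<psi> p) (T c)\<bar> \<le> dist a c"
      if "norm c = 1" for c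
      using blinfun_apply_le_norm[OF \<psi>(1)[OF p], of "T a - T c"] surj_isometry_dist[OF T aS, of c] that
      by (simp add: blinfun.diff_right dist_norm)
    show "blinfun_apply p a \<le> blinfun_apply (\<psi> p) (T a)"
    proof (rule field_le_epsilon)
      fix e :: real assume "e > 0"
      obtain c where c: "c \<in> dual_face p" "dist a c \<le> 1 - blinfun_apply p a + e"
        using near_face[OF p _ \<open>e > 0\<close>, of a] a by auto
      have "T c \<in> dual_face (\<psi> p)" using c(1) \<psi>(2)[OF p] by blast
      then show "blinfun_apply p a \<le> blinfun_apply (\<psi> p) (T a) + e"
        using dT[of c] c by (simp add: dual_face_def)
    qed
    show "blinfun_apply (\<psi> p) (T a) \<le> blinfun_apply p a"
    proof (rule field_le_epsilon)
      fix e :: real assume "e > 0"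
      obtain c where c: "c \<in> dual_face p" "dist (- a) c \<le> 1 - blinfun_apply p (- a) + e"
        using near_face[OF p _ \<open>e > 0\<close>, of "- a"] a by auto
      have "T (- c) \<in> T ` uminus ` dual_face p" using c(1) by blast
      then have "T (- c) \<in> uminus ` dual_face (\<psi> p)"
        using sphere_isometry_max_convex_uminus[OF T faces[OF p]] \<psi>(2)[OF p] by simp
      then have "blinfun_apply (\<psi> p) (T (- c)) = - 1"
        by (auto simp: dual_face_def blinfun.minus_right)
      moreover have "dist a (- c) = dist (- a) c" by (metis dist_minus minus_minus)
      ultimately show "blinfun_apply (\<psi> p) (T a) \<le> blinfun_apply p a + e"
        using dT[of "- c"] c by (simp add: dual_face_def blinfun.minus_right)
    qed
  qed
  have sep: "\<exists>p\<in>P. blinfun_apply (\<psi> p) y \<noteq> 0" if "y \<noteq> 0" for y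
  proof -
    have "y /\<^sub>R norm y \<in> sphere 0 1" using that by simp
    then obtain x where x: "x \<in> sphere 0 1" "T x = y /\<^sub>R norm y" using img by (metis imageE)
    obtain F where F: "F \<in> max_convex_sets" "x \<in> F"
      using convex_subset_sphere_extends[of "{x}"] x(1) by auto
    then obtain p where p: "p \<in> P" "F = dual_face p \<or> F = uminus ` dual_face p"
      using cover[of F] by blast
    then have "\<bar>blinfun_apply p x\<bar> = 1"
      using F(2) by (auto simp: dual_face_def blinfun.minus_right)
    then have "blinfun_apply (\<psi> p) (y /\<^sub>R norm y) \<noteq> 0"
      using conj[OF p(1), of x] x by auto
    then show ?thesis using p(1) by (auto simp: blinfun.scaleR_right)
  qed
  show "\<exists>U. linear U \<and> surj_isometry UNIV UNIV U \<and> (\<forall>x\<in>sphere 0 1. U x = T x)"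
    by (rule homogeneous_extension[where I = P and \<phi> = "\<lambda>p. p", OF img conj sep])
qed

end
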